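(* Consider the two-stage GOPA model with $I$ experts, $J$ attributes, expert ranks $t_i$, attribute ranks $s_{ij}$, and no missing or duplicate rankings of the alternatives (all $c_{ijr}=1$). Then the weights of experts $W_i^{\mathcal Q}$, $i\in[I]$, and of attributes $W_j^{\mathcal N}$, $j\in[J]$, are independent of the experts' risk preferences toward the attributes: for any two assignments of global utility structures (risk preferences) to the pairs $(i,j)$ for which the first-stage problems have optimal solutions, the resulting values of $W_i^{\mathcal Q}$ for all $i$ and of $W_j^{\mathcal N}$ for all $j$ coincide.
   Context: $[n]=\{1,\dots,n\}$; $0\ln0=0$. Let $i\in[I]$ index experts and $j\in[J]$ attributes; $t_i,s_{ij}$ are fixed positive integers; $K_{ij}$ is the number of ranks used for alternatives under $(i,j)$ (equal to the number $K$ of alternatives when there are no missing or duplicate rankings); $\mathcal U=\{(i,j,r):i\in[I],j\in[J],r\in[K_{ij}]\}$. First stage. The risk preference of expert $i$ toward attribute $j$ is encoded by a global utility structure assigned to $(i,j)$, which is either discrete, i.e. a positive target vector $V(r)$, $r\in[K_{ij}]$, or continuous, i.e. a positive integrable target density $v$ on $(0,K_{ij}]$. Discrete case: $U^*_{ij}$ minimizes $\sum_{r=1}^{K_{ij}}U(r)\ln\frac{U(r)}{V(r)}$ over vectors $U\in\mathbb R^{K_{ij}}$ with $U(r)\ge0$, $\sum_rU(r)=1$, $U(r)\ge U(r+1)$ for $r\in[K_{ij}-1]$, and finitely many given constraints of the forms $U(r)=\alpha U(r+1)$, $U(r)-U(r+1)=\beta$, $U(r)\ge\gamma$. Put $U^*_{ijr}=U^*_{ij}(r)$.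 Continuous case: $u^*_{ij}$ minimizes $\int_0^{K_{ij}}u\ln(u/v)\,dx$ over integrable $u\ge0$ on $[0,K_{ij}]$ with $\int_0^{K_{ij}}u\,dx=1$ and finitely many given constraints of the forms $\int_0^ru\,dx=\alpha\int_0^{r-1}u\,dx$, $\int_0^ru\,dx-\int_0^{r-1}u\,dx=\beta$, $\int_0^ru\,dx=\gamma$. Put $U^*_{ijr}=\int_0^ru^*_{ij}(K_{ij}-x)\,dx\Big/\sum_{r'=1}^{K_{ij}}\int_0^{r'}u^*_{ij}(K_{ij}-x)\,dx$. Second stage. With $c_{ijr}$ the number of alternatives given rank $r$ by expert $i$ under attribute $j$, let $w^*_{ijr}$ be the optimal solution of $$\max_{\mathbf w,z}z\ \text{ s.t. }K_{ij}U^*_{ijr}z\le t_is_{ij}w_{ijr}\ \forall(i,j,r)\in\mathcal U,\quad\sum_{(i,j,r)\in\mathcal U}c_{ijr}w_{ijr}=1,\quad w_{ijr}\ge0.$$ When there are no missing or duplicate rankings, $W_i^{\mathcal Q}=\sum_{j=1}^J\sum_{r=1}^{K_{ij}}w^*_{ijr}$ and $W_j^{\mathcal N}=\sum_{i=1}^I\sum_{r=1}^{K_{ij}}w^*_{ijr}$. *)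

theory Defs
  imports "HOL-Analysis.Analysis"
begin

text \<open>Rankings. A partial map \<open>\<rho>\<close> sends an alternative to its rank; unranked alternatives
  are mapped to \<^const>\<open>None\<close>. The ranks in use are consecutive from 1, so that
  \<open>num_ranks\<close> is both their number and the largest one.\<close>

definition used_ranks :: "'a set \<Rightarrow> ('a \<rightharpoonup> nat) \<Rightarrow> nat set" where
  "used_ranks X \<rho> = {r. \<exists>a\<in>X. \<rho> a = Some r}"

definition num_ranks :: "'a set \<Rightarrow> ('a \<rightharpoonup> nat) \<Rightarrow> nat" where
  "num_ranks X \<rho> = card (used_ranks X \<rho>)"

definition is_ranking :: "'a set \<Rightarrow> ('a \<rightharpoonup> nat) \<Rightarrow> bool" where
  "is_ranking X \<rho> \<longleftrightarrow> used_ranks X \<rho> = {1..num_ranks X \<rho>}"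

definition rank_count :: "'a set \<Rightarrow> ('a \<rightharpoonup> nat) \<Rightarrow> nat \<Rightarrow> nat" where
  "rank_count X \<rho> r = card {a\<in>X. \<rho> a = Some r}"

definition no_missing :: "'a set \<Rightarrow> ('a \<rightharpoonup> nat) \<Rightarrow> bool" where
  "no_missing X \<rho> \<longleftrightarrow> X \<subseteq> dom \<rho>"

definition no_duplicates :: "'a set \<Rightarrow> ('a \<rightharpoonup> nat) \<Rightarrow> bool" where
  "no_duplicates X \<rho> \<longleftrightarrow> inj_on \<rho> (X \<inter> dom \<rho>)"

lemma num_ranks_complete:
  assumes "no_missing X \<rho>" "no_duplicates X \<rho>"
  shows "num_ranks X \<rho> = card X"
proof -
  have X: "X \<inter> dom \<rho> = X" using assms(1) by (auto simp: no_missing_def)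
  have "Some ` used_ranks X \<rho> = \<rho> ` X"
  proof (intro set_eqI iffI)
    fix y assume "y \<in> \<rho> ` X"
    then obtain a where a: "a \<in> X" "y = \<rho> a" by blast
    then obtain r where "\<rho> a = Some r" using X by blast
    then show "y \<in> Some ` used_ranks X \<rho>" using a by (auto simp: used_ranks_def)
  next
    fix y assume "y \<in> Some ` used_ranks X \<rho>"
    then obtain a r where "a \<in> X" "\<rho> a = Some r" "y = Some r"
      unfolding used_ranks_def by blast
    then show "y \<in> \<rho> ` X" by (metis imageI)
  qed
  moreover have "inj_on \<rho> X" using assms(2) X by (simp add: no_duplicates_def)
  moreover have "card (Some ` used_ranks X \<rho>) = card (used_ranks X \<rho>)"
    by (rule card_image) simp
  ultimately show ?thesis
    by (simp add: num_ranks_def card_image)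
qed

lemma rank_count_complete:
  assumes "no_missing X \<rho>" "no_duplicates X \<rho>" "is_ranking X \<rho>"
    and "r \<in> {1..num_ranks X \<rho>}"
  shows "rank_count X \<rho> r = 1"
proof -
  have X: "X \<inter> dom \<rho> = X" using assms(1) by (auto simp: no_missing_def)
  have "r \<in> used_ranks X \<rho>" using assms(3,4) unfolding is_ranking_def by blast
  then obtain a where a: "a \<in> X" "\<rho> a = Some r"
    unfolding used_ranks_def by blast
  have inj: "inj_on \<rho> X" using assms(2) X by (simp add: no_duplicates_def)
  have "b = a" if "b \<in> X" "\<rho> b = Some r" for b
    using inj_onD[OF inj, of b a] a that by simp
  then have "{b\<in>X. \<rho> b = Some r} = {a}" using a by blast
  then show ?thesis by (simp add: rank_count_def)
qed

text \<open>Side constraints on the discrete utilities \<open>U(r)\<close> and on the continuous density \<open>u\<close>.\<close>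

datatype discrete_constraint =
    DRatio nat real   \<comment> \<open>\<open>U(r) = \<alpha> U(r+1)\<close>\<close>
  | DDiff nat real    \<comment> \<open>\<open>U(r) - U(r+1) = \<beta>\<close>\<close>
  | DLower nat real   \<comment> \<open>\<open>U(r) \<ge> \<gamma>\<close>\<close>

datatype continuous_constraint =
    CRatio nat real   \<comment> \<open>mass of \<open>[0,r]\<close> is \<open>\<alpha>\<close> times the mass of \<open>[0,r-1]\<close>\<close>
  | CDiff nat real    \<comment> \<open>masses of \<open>[0,r]\<close> and \<open>[0,r-1]\<close> differ by \<open>\<beta>\<close>\<close>
  | CMass nat real    \<comment> \<open>mass of \<open>[0,r]\<close> is \<open>\<gamma>\<close>\<close>

fun sat_discrete :: "(nat \<Rightarrow> real) \<Rightarrow> discrete_constraint \<Rightarrow> bool" where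
  "sat_discrete U (DRatio r \<alpha>) \<longleftrightarrow> U r = \<alpha> * U (r + 1)"
| "sat_discrete U (DDiff r \<beta>) \<longleftrightarrow> U r - U (r + 1) = \<beta>"
| "sat_discrete U (DLower r \<gamma>) \<longleftrightarrow> U r \<ge> \<gamma>"

fun sat_continuous :: "(real \<Rightarrow> real) \<Rightarrow> continuous_constraint \<Rightarrow> bool" where
  "sat_continuous u (CRatio r \<alpha>) \<longleftrightarrow>
     integral {0..real r} u = \<alpha> * integral {0..real r - 1} u"
| "sat_continuous u (CDiff r \<beta>) \<longleftrightarrow>
     integral {0..real r} u - integral {0..real r - 1} u = \<beta>"
| "sat_continuous u (CMass r \<gamma>) \<longleftrightarrow> integral {0..real r} u = \<gamma>"

fun discrete_range :: "nat \<Rightarrow> discrete_constraint \<Rightarrow> bool" where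
  "discrete_range K (DRatio r \<alpha>) \<longleftrightarrow> 1 \<le> r \<and> r < K"
| "discrete_range K (DDiff r \<beta>) \<longleftrightarrow> 1 \<le> r \<and> r < K"
| "discrete_range K (DLower r \<gamma>) \<longleftrightarrow> 1 \<le> r \<and> r \<le> K"

fun continuous_range :: "nat \<Rightarrow> continuous_constraint \<Rightarrow> bool" where
  "continuous_range K (CRatio r \<alpha>) \<longleftrightarrow> 1 \<le> r \<and> r \<le> K"
| "continuous_range K (CDiff r \<beta>) \<longleftrightarrow> 1 \<le> r \<and> r \<le> K"
| "continuous_range K (CMass r \<gamma>) \<longleftrightarrow> 1 \<le> r \<and> r \<le> K"

text \<open>A global utility structure: target and side constraints.\<close>

datatype utility_structure =
    Discrete "nat \<Rightarrow> real" "discrete_constraint list"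
  | Continuous "real \<Rightarrow> real" "continuous_constraint list"

fun valid_structure :: "nat \<Rightarrow> utility_structure \<Rightarrow> bool" where
  "valid_structure K (Discrete V C) \<longleftrightarrow>
     (\<forall>r\<in>{1..K}. V r > 0) \<and> (\<forall>k\<in>set C. discrete_range K k)"
| "valid_structure K (Continuous v C) \<longleftrightarrow>
     (\<forall>x\<in>{0<..real K}. v x > 0) \<and> v absolutely_integrable_on {0<..real K} \<and>
     (\<forall>k\<in>set C. continuous_range K k)"

subsection \<open>First stage\<close>

text \<open>In both objectives a zero utility contributes 0, because \<open>0 * ln y = 0\<close> for every \<open>y\<close>.\<close>

definition discrete_obj :: "nat \<Rightarrow> (nat \<Rightarrow> real) \<Rightarrow> (nat \<Rightarrow> real) \<Rightarrow> real" where
  "discrete_obj K V U = (\<Sum>r=1..K. U r * ln (U r / V r))"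

definition discrete_feasible ::
    "nat \<Rightarrow> discrete_constraint list \<Rightarrow> (nat \<Rightarrow> real) \<Rightarrow> bool" where
  "discrete_feasible K C U \<longleftrightarrow>
     (\<forall>r\<in>{1..K}. U r \<ge> 0) \<and> (\<Sum>r=1..K. U r) = 1 \<and>
     (\<forall>r\<in>{1..<K}. U r \<ge> U (r + 1)) \<and> (\<forall>k\<in>set C. sat_discrete U k)"

definition discrete_optimal ::
    "nat \<Rightarrow> (nat \<Rightarrow> real) \<Rightarrow> discrete_constraint list \<Rightarrow> (nat \<Rightarrow> real) \<Rightarrow> bool" where
  "discrete_optimal K V C U \<longleftrightarrow> discrete_feasible K C U \<and>
     (\<forall>U'. discrete_feasible K C U' \<longrightarrow> discrete_obj K V U \<le> discrete_obj K V U')"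

text \<open>Since \<open>u ln (u/v) \<ge> u - v\<close>, for integrable \<open>u\<close> and \<open>v\<close> the negative part of the integrand is
  integrable, so the integral exists in \<open>(-\<infinity>, \<infinity>]\<close> and non-integrability means that it is
  \<open>\<infinity>\<close>. The library integral alone would return 0 in that case.\<close>

definition continuous_obj :: "nat \<Rightarrow> (real \<Rightarrow> real) \<Rightarrow> (real \<Rightarrow> real) \<Rightarrow> ereal" where
  "continuous_obj K v u =
     (if (\<lambda>x. u x * ln (u x / v x)) absolutely_integrable_on {0..real K}
      then ereal (integral {0..real K} (\<lambda>x. u x * ln (u x / v x))) else \<infinity>)"

definition continuous_feasible ::
    "nat \<Rightarrow> continuous_constraint list \<Rightarrow> (real \<Rightarrow> real) \<Rightarrow> bool" where
  "continuous_feasible K C u \<longleftrightarrow>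
     u absolutely_integrable_on {0..real K} \<and> (\<forall>x\<in>{0..real K}. u x \<ge> 0) \<and>
     integral {0..real K} u = 1 \<and> (\<forall>k\<in>set C. sat_continuous u k)"

definition continuous_optimal ::
    "nat \<Rightarrow> (real \<Rightarrow> real) \<Rightarrow> continuous_constraint list \<Rightarrow> (real \<Rightarrow> real) \<Rightarrow> bool" where
  "continuous_optimal K v C u \<longleftrightarrow> continuous_feasible K C u \<and>
     (\<forall>u'. continuous_feasible K C u' \<longrightarrow> continuous_obj K v u \<le> continuous_obj K v u')"

text \<open>\<open>first_stage K g U\<close>: the values \<open>U(1), \<dots>, U(K)\<close> arise from an optimal solution of the
  first-stage problem for the structure \<open>g\<close>.\<close>

fun first_stage :: "nat \<Rightarrow> utility_structure \<Rightarrow> (nat \<Rightarrow> real) \<Rightarrow> bool" where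
  "first_stage K (Discrete V C) U \<longleftrightarrow> discrete_optimal K V C U"
| "first_stage K (Continuous v C) U \<longleftrightarrow>
     (\<exists>u. continuous_optimal K v C u \<and>
       (\<forall>r\<in>{1..K}. U r = integral {0..real r} (\<lambda>x. u (real K - x)) /
          (\<Sum>r'=1..K. integral {0..real r'} (\<lambda>x. u (real K - x)))))"

subsection \<open>Second stage\<close>

definition gopa_index :: "nat \<Rightarrow> nat \<Rightarrow> (nat \<Rightarrow> nat \<Rightarrow> nat) \<Rightarrow> (nat \<times> nat \<times> nat) set" where
  "gopa_index I J K = {(i, j, r). i \<in> {1..I} \<and> j \<in> {1..J} \<and> r \<in> {1..K i j}}"

definition gopa_feasible ::
    "nat \<Rightarrow> nat \<Rightarrow> (nat \<Rightarrow> nat \<Rightarrow> nat) \<Rightarrow> (nat \<Rightarrow> nat \<Rightarrow> nat \<Rightarrow> nat) \<Rightarrow>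
     (nat \<Rightarrow> nat) \<Rightarrow> (nat \<Rightarrow> nat \<Rightarrow> nat) \<Rightarrow> (nat \<Rightarrow> nat \<Rightarrow> nat \<Rightarrow> real) \<Rightarrow>
     (nat \<Rightarrow> nat \<Rightarrow> nat \<Rightarrow> real) \<Rightarrow> real \<Rightarrow> bool" where
  "gopa_feasible I J K c t s U w z \<longleftrightarrow>
     (\<forall>(i, j, r)\<in>gopa_index I J K.
        real (K i j) * U i j r * z \<le> real (t i) * real (s i j) * w i j r) \<and>
     (\<Sum>(i, j, r)\<in>gopa_index I J K. real (c i j r) * w i j r) = 1 \<and>
     (\<forall>(i, j, r)\<in>gopa_index I J K. w i j r \<ge> 0)"

definition gopa_optimal ::
    "nat \<Rightarrow> nat \<Rightarrow> (nat \<Rightarrow> nat \<Rightarrow> nat) \<Rightarrow> (nat \<Rightarrow> nat \<Rightarrow> nat \<Rightarrow> nat) \<Rightarrow>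
     (nat \<Rightarrow> nat) \<Rightarrow> (nat \<Rightarrow> nat \<Rightarrow> nat) \<Rightarrow> (nat \<Rightarrow> nat \<Rightarrow> nat \<Rightarrow> real) \<Rightarrow>
     (nat \<Rightarrow> nat \<Rightarrow> nat \<Rightarrow> real) \<Rightarrow> real \<Rightarrow> bool" where
  "gopa_optimal I J K c t s U w z \<longleftrightarrow> gopa_feasible I J K c t s U w z \<and>
     (\<forall>w' z'. gopa_feasible I J K c t s U w' z' \<longrightarrow> z' \<le> z)"

definition expert_weight ::
    "nat \<Rightarrow> (nat \<Rightarrow> nat \<Rightarrow> nat) \<Rightarrow> (nat \<Rightarrow> nat \<Rightarrow> nat \<Rightarrow> real) \<Rightarrow> nat \<Rightarrow> real" where
  "expert_weight J K w i = (\<Sum>j=1..J. \<Sum>r=1..K i j. w i j r)"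

definition attribute_weight ::
    "nat \<Rightarrow> (nat \<Rightarrow> nat \<Rightarrow> nat) \<Rightarrow> (nat \<Rightarrow> nat \<Rightarrow> nat \<Rightarrow> real) \<Rightarrow> nat \<Rightarrow> real" where
  "attribute_weight I K w j = (\<Sum>i=1..I. \<Sum>r=1..K i j. w i j r)"

end

theory Submission
  imports Defs
begin

text \<open>Normalised utilities sum to 1 over the ranks of each pair \<open>(i, j)\<close>. Summing the constraints of
  the linear program gives \<open>z \<le> 1 / S\<close> with \<open>S = \<Sum>\<^sub>i\<^sub>j K\<^sub>i\<^sub>j / (t\<^sub>i s\<^sub>i\<^sub>j)\<close>, whatever the utilities are. At
  the optimum this bound is attained, so all constraints are tight and the weights of the pair
  \<open>(i, j)\<close> add up to \<open>K\<^sub>i\<^sub>j / (t\<^sub>i s\<^sub>i\<^sub>j S)\<close>. Expert and attribute weights are sums of these.\<close>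

text \<open>Reflection at 0 followed by translation by \<open>a\<close>. It identifies the last
  integral of the reversed density in the continuous first stage with the full mass of the
  density.\<close>

lemma integral_reflect_Icc:
  fixes f :: "real \<Rightarrow> real"
  shows "integral {0..a} (\<lambda>x. f (a - x)) = integral {0..a} f"
proof -
  have "integral {0..a} (\<lambda>x. f (a - x)) = integral {-a..0} (\<lambda>x. f (a + x))"
    using Henstock_Kurzweil_Integration.integral_reflect_real[of 0 "-a" "\<lambda>x. f (a + x)"] by simp
  also have "\<dots> = integral {0..a} f"
    using integral_shift_Icc_real[of "-a" 0 f a] by (simp add: o_def)
  finally show ?thesis .
qed

text \<open>These two properties are all that the second stage uses of a first-stage solution. In
  the discrete case they are constraints of the problem; in the continuous case they come from the
  quotient defining \<open>U r\<close>, once its denominator is known to be positive.\<close>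

lemma first_stage_normalized:
  assumes "K \<ge> 1" and "first_stage K g U"
  shows "\<forall>r\<in>{1..K}. U r \<ge> 0" and "(\<Sum>r=1..K. U r) = 1"
proof -
  have "(\<forall>r\<in>{1..K}. U r \<ge> 0) \<and> (\<Sum>r=1..K. U r) = 1"
  proof (cases g)
    case (Discrete V C)
    then show ?thesis
      using assms(2) by (simp add: discrete_optimal_def discrete_feasible_def)
  next
    case (Continuous v C)
    then obtain u where u: "continuous_optimal K v C u"
      and U: "\<And>r. r \<in> {1..K} \<Longrightarrow> U r = integral {0..real r} (\<lambda>x. u (real K - x)) /
          (\<Sum>r'=1..K. integral {0..real r'} (\<lambda>x. u (real K - x)))"
      using assms(2) by auto
    define G where "G r = integral {0..real r} (\<lambda>x. u (real K - x))" for r :: nat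
    have u0: "\<forall>x\<in>{0..real K}. u x \<ge> 0" and u1: "integral {0..real K} u = 1"
      using u by (auto simp: continuous_optimal_def continuous_feasible_def)
    have G0: "G r \<ge> 0" if "r \<in> {1..K}" for r
    \<comment> \<open>The split covers the default value 0 that \<open>integral\<close> takes on a
      non-integrable function.\<close>
    proof (cases "(\<lambda>x. u (real K - x)) integrable_on {0..real r}")
      case True
      then show ?thesis
        unfolding G_def using u0 that by (intro integral_nonneg) auto
    qed (simp add: G_def not_integrable_integral)
    have "G K = 1"
      unfolding G_def by (simp add: integral_reflect_Icc u1)
    \<comment> \<open>The term with \<open>r = K\<close> alone contributes 1, so the denominator is
      not 0; division by 0 would make every \<open>U r\<close> equal to 0.\<close>
    moreover have "G K \<le> (\<Sum>r=1..K. G r)"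
      using G0 assms(1) by (intro member_le_sum) auto
    ultimately have pos: "(\<Sum>r=1..K. G r) > 0" by linarith
    have UG: "U r = G r / (\<Sum>r'=1..K. G r')" if "r \<in> {1..K}" for r
      using U[OF that] by (simp add: G_def)
    have "(\<Sum>r=1..K. U r) = (\<Sum>r=1..K. G r / (\<Sum>r'=1..K. G r'))"
      by (intro sum.cong UG) auto
    also have "\<dots> = 1"
      using pos by (simp flip: sum_divide_distrib)
    finally show ?thesis
      using UG G0 pos by (auto intro!: divide_nonneg_pos)
  qed
  then show "\<forall>r\<in>{1..K}. U r \<ge> 0" and "(\<Sum>r=1..K. U r) = 1" by auto
qed

lemma sum_gopa_index:
  "(\<Sum>(i, j, r)\<in>gopa_index I J K. f i j r) = (\<Sum>i=1..I. \<Sum>j=1..J. \<Sum>r=1..K i j. f i j r)"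
proof -
  have "gopa_index I J K = (SIGMA i:{1..I}. SIGMA j:{1..J}. {1..K i j})"
    by (auto simp: gopa_index_def)
  then show ?thesis
    by (simp add: sum.Sigma)
qed

lemma finite_gopa_index: "finite (gopa_index I J K)"
proof (rule finite_subset)
  show "gopa_index I J K \<subseteq> (SIGMA i:{1..I}. SIGMA j:{1..J}. {1..K i j})"
    by (auto simp: gopa_index_def)
qed auto

text \<open>The second-stage data with a generic normalised utility array \<open>U\<close>, so that
  the linear program is solved once and the result applied to each of the two assignments.\<close>

locale gopa =
  fixes I J :: nat and K :: "nat \<Rightarrow> nat \<Rightarrow> nat" and c :: "nat \<Rightarrow> nat \<Rightarrow> nat \<Rightarrow> nat"
    and t :: "nat \<Rightarrow> nat" and s :: "nat \<Rightarrow> nat \<Rightarrow> nat" and U :: "nat \<Rightarrow> nat \<Rightarrow> nat \<Rightarrow> real"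
  assumes I: "I \<ge> 1" and J: "J \<ge> 1"
    and K: "\<And>i j. i \<in> {1..I} \<Longrightarrow> j \<in> {1..J} \<Longrightarrow> K i j \<ge> 1"
    and c: "\<And>i j r. i \<in> {1..I} \<Longrightarrow> j \<in> {1..J} \<Longrightarrow> r \<in> {1..K i j} \<Longrightarrow> c i j r = 1"
    and t: "\<And>i. i \<in> {1..I} \<Longrightarrow> t i > 0"
    and s: "\<And>i j. i \<in> {1..I} \<Longrightarrow> j \<in> {1..J} \<Longrightarrow> s i j > 0"
    and U0: "\<And>i j r. i \<in> {1..I} \<Longrightarrow> j \<in> {1..J} \<Longrightarrow> r \<in> {1..K i j} \<Longrightarrow> U i j r \<ge> 0"
    and U1: "\<And>i j. i \<in> {1..I} \<Longrightarrow> j \<in> {1..J} \<Longrightarrow> (\<Sum>r=1..K i j. U i j r) = 1"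
begin

text \<open>The coefficient of \<open>U i j r * z\<close> once the constraint is divided by
  \<open>t i * s i j\<close>. It depends neither on \<open>r\<close> nor on
  \<open>U\<close>.\<close>

definition share :: "nat \<Rightarrow> nat \<Rightarrow> real" where
  "share i j = real (K i j) / (real (t i) * real (s i j))"

definition total :: real where
  "total = (\<Sum>i=1..I. \<Sum>j=1..J. share i j)"

lemma share_pos: "i \<in> {1..I} \<Longrightarrow> j \<in> {1..J} \<Longrightarrow> share i j > 0"
  using K[of i j] t[of i] s[of i j] by (simp add: share_def)

lemma total_pos: "total > 0"
  unfolding total_def using I J share_pos by (intro sum_pos) auto

text \<open>The utilities drop out here: \<open>share i j\<close> is constant in \<open>r\<close>,
  so the inner sum collapses by \<open>U1\<close>.\<close>

lemma sum_share_utility: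
  "(\<Sum>(i, j, r)\<in>gopa_index I J K. share i j * U i j r) = total"
  unfolding sum_gopa_index total_def
  by (intro sum.cong refl) (simp only: sum_distrib_left[symmetric] U1 mult_1_right)

lemma feasible_iff:
  "gopa_feasible I J K c t s U w z \<longleftrightarrow>
     (\<forall>(i, j, r)\<in>gopa_index I J K. share i j * U i j r * z \<le> w i j r) \<and>
     (\<Sum>(i, j, r)\<in>gopa_index I J K. w i j r) = 1 \<and>
     (\<forall>(i, j, r)\<in>gopa_index I J K. w i j r \<ge> 0)"
proof -
  have "real (K i j) * U i j r * z \<le> real (t i) * real (s i j) * w i j r \<longleftrightarrow>
      share i j * U i j r * z \<le> w i j r" if "(i, j, r) \<in> gopa_index I J K" for i j r
  proof -
    have "real (t i) * real (s i j) > 0"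
      using that t[of i] s[of i j] by (simp add: gopa_index_def)
    then show ?thesis
      by (simp add: share_def field_simps)
  qed
  moreover have "(\<Sum>(i, j, r)\<in>gopa_index I J K. real (c i j r) * w i j r) =
      (\<Sum>(i, j, r)\<in>gopa_index I J K. w i j r)"
    by (rule sum.cong) (auto simp: gopa_index_def c)
  ultimately show ?thesis
    unfolding gopa_feasible_def by (intro arg_cong2[where f = "(\<and>)"] ball_cong refl) auto
qed

lemma feasible_bound:
  assumes "gopa_feasible I J K c t s U w z"
  shows "z \<le> 1 / total"
proof -
  have "total * z = (\<Sum>(i, j, r)\<in>gopa_index I J K. share i j * U i j r * z)"
    by (simp add: sum_distrib_right case_prod_unfold flip: sum_share_utility)
  also have "\<dots> \<le> (\<Sum>(i, j, r)\<in>gopa_index I J K. w i j r)"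
    using assms unfolding feasible_iff by (intro sum_mono) auto
  also have "\<dots> = 1"
    using assms by (simp add: feasible_iff)
  finally show ?thesis
    using total_pos by (simp add: field_simps)
qed

text \<open>Turning every constraint into an equality at \<open>z = 1 / total\<close> yields weights
  of sum 1 by \<open>sum_share_utility\<close>. Hence the upper bound on \<open>z\<close> is
  attained and an optimum exists.\<close>

lemma tight_feasible:
  "gopa_feasible I J K c t s U (\<lambda>i j r. share i j * U i j r * (1 / total)) (1 / total)"
proof -
  have "(\<Sum>(i, j, r)\<in>gopa_index I J K. share i j * U i j r * (1 / total)) = total * (1 / total)"
    unfolding sum_share_utility[symmetric] sum_distrib_right by (simp add: case_prod_unfold)
  moreover have "share i j * U i j r * (1 / total) \<ge> 0" if "(i, j, r) \<in> gopa_index I J K" for i j r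
    using that U0[of i j r] share_pos[of i j] total_pos by (auto simp: gopa_index_def)
  ultimately show ?thesis
    unfolding feasible_iff using total_pos by auto
qed

lemma optimal_exists: "\<exists>w z. gopa_optimal I J K c t s U w z"
  unfolding gopa_optimal_def using tight_feasible feasible_bound by blast

text \<open>The slacks of the constraints are nonnegative and add up to
  \<open>1 - total * z\<close>, which is 0 at the optimal \<open>z\<close>; so each slack
  vanishes.\<close>

lemma optimal_tight:
  assumes "gopa_optimal I J K c t s U w z" and "(i, j, r) \<in> gopa_index I J K"
  shows "w i j r = share i j * U i j r / total"
proof -
  have feas: "gopa_feasible I J K c t s U w z"
    using assms(1) by (simp add: gopa_optimal_def)
  have z: "z = 1 / total"
    using assms(1) tight_feasible feasible_bound[OF feas]
    unfolding gopa_optimal_def by (blast intro: order_antisym)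
  define d where "d = (\<lambda>(i, j, r). w i j r - share i j * U i j r * z)"
  have "sum d (gopa_index I J K) = (\<Sum>(i, j, r)\<in>gopa_index I J K. w i j r) -
      (\<Sum>(i, j, r)\<in>gopa_index I J K. share i j * U i j r) * z"
    unfolding d_def sum_distrib_right sum_subtractf[symmetric] by (simp add: case_prod_unfold)
  also have "\<dots> = 0"
    using feas total_pos unfolding feasible_iff sum_share_utility z by simp
  finally have "sum d (gopa_index I J K) = 0" .
  moreover have "\<And>p. p \<in> gopa_index I J K \<Longrightarrow> d p \<ge> 0"
    using feas unfolding feasible_iff d_def by auto
  ultimately have "d (i, j, r) = 0"
    using assms(2) sum_nonneg_eq_0_iff[OF finite_gopa_index] by blast
  then show ?thesis
    by (simp add: d_def z)
qed

text \<open>Summing the tight weights over \<open>r\<close> removes \<open>U\<close> by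
  \<open>U1\<close>. The value is spelled out in \<open>K\<close>, \<open>t\<close> and
  \<open>s\<close> so that it reads the same for every choice of \<open>U\<close>.\<close>

lemma optimal_pair_weight:
  assumes "gopa_optimal I J K c t s U w z" and "i \<in> {1..I}" and "j \<in> {1..J}"
  shows "(\<Sum>r=1..K i j. w i j r) =
    real (K i j) / (real (t i) * real (s i j)) /
      (\<Sum>i=1..I. \<Sum>j=1..J. real (K i j) / (real (t i) * real (s i j)))"
proof -
  have "(\<Sum>r=1..K i j. w i j r) = (\<Sum>r=1..K i j. share i j / total * U i j r)"
    using assms by (intro sum.cong refl) (simp add: optimal_tight gopa_index_def)
  also have "\<dots> = share i j / total"
    using assms by (simp only: sum_distrib_left[symmetric] U1 mult_1_right)
  finally show ?thesis
    by (simp add: share_def total_def)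
qed

end

text \<open>The two existence claims keep the comparison of optimal solutions from being
  vacuous.\<close>

theorem corollary5:
  fixes I J :: nat
    and X :: "'a set"
    and \<rho> :: "nat \<Rightarrow> nat \<Rightarrow> 'a \<rightharpoonup> nat"
    and t :: "nat \<Rightarrow> nat" and s :: "nat \<Rightarrow> nat \<Rightarrow> nat"
    and A B :: "nat \<Rightarrow> nat \<Rightarrow> utility_structure"
    and UA UB :: "nat \<Rightarrow> nat \<Rightarrow> nat \<Rightarrow> real"
    and K :: "nat \<Rightarrow> nat \<Rightarrow> nat" and c :: "nat \<Rightarrow> nat \<Rightarrow> nat \<Rightarrow> nat"
  assumes "\<And>i j. i \<in> {1..I} \<Longrightarrow> j \<in> {1..J} \<Longrightarrow> K i j = num_ranks X (\<rho> i j)"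
    and "\<And>i j r. i \<in> {1..I} \<Longrightarrow> j \<in> {1..J} \<Longrightarrow> r \<in> {1..K i j} \<Longrightarrow>
           c i j r = rank_count X (\<rho> i j) r"
    and "I \<ge> 1" and "J \<ge> 1"
    and "finite X" and "X \<noteq> {}"
    and "\<And>i. i \<in> {1..I} \<Longrightarrow> t i > 0"
    and "\<And>i j. i \<in> {1..I} \<Longrightarrow> j \<in> {1..J} \<Longrightarrow> s i j > 0"
    and "\<And>i j. i \<in> {1..I} \<Longrightarrow> j \<in> {1..J} \<Longrightarrow> is_ranking X (\<rho> i j)"
    and "\<And>i j. i \<in> {1..I} \<Longrightarrow> j \<in> {1..J} \<Longrightarrow> no_missing X (\<rho> i j)"
    and "\<And>i j. i \<in> {1..I} \<Longrightarrow> j \<in> {1..J} \<Longrightarrow> no_duplicates X (\<rho> i j)"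
    and "\<And>i j. i \<in> {1..I} \<Longrightarrow> j \<in> {1..J} \<Longrightarrow> valid_structure (K i j) (A i j)"
    and "\<And>i j. i \<in> {1..I} \<Longrightarrow> j \<in> {1..J} \<Longrightarrow> valid_structure (K i j) (B i j)"
    and "\<And>i j. i \<in> {1..I} \<Longrightarrow> j \<in> {1..J} \<Longrightarrow> first_stage (K i j) (A i j) (UA i j)"
    and "\<And>i j. i \<in> {1..I} \<Longrightarrow> j \<in> {1..J} \<Longrightarrow> first_stage (K i j) (B i j) (UB i j)"
  shows "(\<exists>w z. gopa_optimal I J K c t s UA w z) \<and>
         (\<exists>w z. gopa_optimal I J K c t s UB w z) \<and>
         (\<forall>w z w' z'. gopa_optimal I J K c t s UA w z \<longrightarrow> gopa_optimal I J K c t s UB w' z' \<longrightarrow>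
            (\<forall>i\<in>{1..I}. expert_weight J K w i = expert_weight J K w' i) \<and>
            (\<forall>j\<in>{1..J}. attribute_weight I K w j = attribute_weight I K w' j))"
proof -
  \<comment> \<open>A complete ranking without ties uses \<open>card X\<close> ranks, and
    \<open>X\<close> is finite and nonempty.\<close>
  have K: "K i j \<ge> 1" if "i \<in> {1..I}" "j \<in> {1..J}" for i j
    using assms(1,10,11)[OF that] assms(5,6) by (simp add: num_ranks_complete Suc_le_eq card_gt_0_iff)
  have c: "c i j r = 1" if "i \<in> {1..I}" "j \<in> {1..J}" "r \<in> {1..K i j}" for i j r
    using assms(2)[OF that] assms(1,9,10,11)[OF that(1,2)] that(3) by (simp add: rank_count_complete)
  interpret A: gopa I J K c t s UA
    using assms(3,4,7,8) K c first_stage_normalized[OF K assms(14)] by unfold_locales auto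
  interpret B: gopa I J K c t s UB
    using assms(3,4,7,8) K c first_stage_normalized[OF K assms(15)] by unfold_locales auto
  \<comment> \<open>Already the weight of each single pair agrees, since both sides have the same
    closed form; expert and attribute weights then agree term by term.\<close>
  have eq: "(\<Sum>r=1..K i j. w i j r) = (\<Sum>r=1..K i j. w' i j r)"
    if "gopa_optimal I J K c t s UA w z" "gopa_optimal I J K c t s UB w' z'"
      "i \<in> {1..I}" "j \<in> {1..J}" for w z w' z' i j
    using A.optimal_pair_weight[OF that(1,3,4)] B.optimal_pair_weight[OF that(2,3,4)] by simp
  have "expert_weight J K w i = expert_weight J K w' i"
    if "gopa_optimal I J K c t s UA w z" "gopa_optimal I J K c t s UB w' z'" "i \<in> {1..I}"
    for w z w' z' i
    unfolding expert_weight_def by (rule sum.cong[OF refl]) (rule eq[OF that(1,2)], use that in auto)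
  moreover have "attribute_weight I K w j = attribute_weight I K w' j"
    if "gopa_optimal I J K c t s UA w z" "gopa_optimal I J K c t s UB w' z'" "j \<in> {1..J}"
    for w z w' z' j
    unfolding attribute_weight_def by (rule sum.cong[OF refl]) (rule eq[OF that(1,2)], use that in auto)
  ultimately show ?thesis
    using A.optimal_exists B.optimal_exists by blast
qed

end
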